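(* Let $\alpha,\beta\in\mathbb{C}$, let $A_1,A_2,A_3,A_4\in\mathbb{C}$ be non-zero, and let $(A_n)_{n\in\mathbb{Z}}$ be the Somos 4 sequence defined by $$A_{n+4}A_n=\alpha\,A_{n+3}A_{n+1}+\beta\,(A_{n+2})^2$$ with initial data $A_1,A_2,A_3,A_4$. Put $$T=\frac{A_1^2A_4^2+\alpha\,(A_2^3A_4+A_1A_3^3)+\beta\,A_2^2A_3^2}{A_1A_2A_3A_4},\qquad \mathcal{I}=\alpha^2+\beta T .$$ Then $$A_n\in\mathcal{R}=\mathbb{Z}[\alpha,\beta,\mathcal{I},A_1^{\pm1},A_2,A_3,A_4]\qquad\text{for all } n\ge 1,$$ where $\mathcal{R}$ denotes the ring generated over $\mathbb{Z}$ by $\alpha,\beta,\mathcal{I},A_1,A_1^{-1},A_2,A_3,A_4$.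
   Context: The recurrence is iterated forwards and backwards from four adjacent non-zero values $A_1,\dots,A_4$, giving a sequence indexed by $\mathbb{Z}$. Convention on zeros: if a zero term is encountered, the sequence is analytically continued through it. That is, $A_n$ is by definition the value at the given data of the rational function of $\alpha,\beta,A_1,A_2,A_3,A_4$ obtained by iterating the recurrence formally with these six quantities as indeterminates; it is known (the Laurent property of Fomin and Zelevinsky) that this rational function lies in $\mathbb{Z}[\alpha,\beta,A_1^{\pm1},A_2^{\pm1},A_3^{\pm1},A_4^{\pm1}]$, so its value is well defined whenever $A_1,A_2,A_3,A_4$ are non-zero. The quantity $T$ is called the translation invariant of the sequence. *)

theory Defs
  imports
    Complex_Main
    "HOL-Library.Poly_Mapping"
    "HOL-Computational_Algebra.Fraction_Field"
    "HOL-Algebra.Generated_Rings"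
    "HOL-Algebra.Algebraic_Closure_Type"
begin

text \<open>The six indeterminates: the two coefficients and the four initial values. The linear order
  is immaterial; it is what makes the polynomial ring over them an integral domain in the library.\<close>

datatype indet = Alpha | Beta | X1 | X2 | X3 | X4

primrec indet_rank :: "indet \<Rightarrow> nat" where
  "indet_rank Alpha = 0"
| "indet_rank Beta = 1"
| "indet_rank X1 = 2"
| "indet_rank X2 = 3"
| "indet_rank X3 = 4"
| "indet_rank X4 = 5"

instantiation indet :: linorder
begin

definition less_eq_indet :: "indet \<Rightarrow> indet \<Rightarrow> bool" where
  "x \<le> y \<longleftrightarrow> indet_rank x \<le> indet_rank y"

definition less_indet :: "indet \<Rightarrow> indet \<Rightarrow> bool" where
  "x < y \<longleftrightarrow> indet_rank x < indet_rank y"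

instance
proof
  fix x y :: indet
  show "x \<le> y \<Longrightarrow> y \<le> x \<Longrightarrow> x = y"
    by (cases x; cases y) (simp_all add: less_eq_indet_def)
qed (auto simp: less_eq_indet_def less_indet_def)

end

text \<open>Polynomials with integer coefficients, as finitely supported functions on monomials, and
  the field of rational functions, as their fraction field.\<close>

type_synonym int_poly = "(indet \<Rightarrow>\<^sub>0 nat) \<Rightarrow>\<^sub>0 int"
type_synonym ratfun = "int_poly fract"

definition poly_value :: "(indet \<Rightarrow> complex) \<Rightarrow> int_poly \<Rightarrow> complex" where
  "poly_value x p =
     (\<Sum>m\<in>Poly_Mapping.keys p. of_int (Poly_Mapping.lookup p m) *
        (\<Prod>i\<in>Poly_Mapping.keys m. x i ^ Poly_Mapping.lookup m i))"

text \<open>A rational function may be written with any denominator that does not vanish at the point;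
  the value does not depend on this choice. If there is no such denominator, the rational
  function has no value at the point and \<open>ratfun_value\<close> is unspecified.\<close>

definition has_value_at :: "ratfun \<Rightarrow> (indet \<Rightarrow> complex) \<Rightarrow> complex \<Rightarrow> bool" where
  "has_value_at r x v \<longleftrightarrow>
     (\<exists>p q. r = Fract p q \<and> poly_value x q \<noteq> 0 \<and> v = poly_value x p / poly_value x q)"

definition ratfun_value :: "ratfun \<Rightarrow> (indet \<Rightarrow> complex) \<Rightarrow> complex" where
  "ratfun_value r x = (THE v. has_value_at r x v)"

definition indet_fun :: "indet \<Rightarrow> ratfun" where
  "indet_fun i = Fract (Poly_Mapping.single (Poly_Mapping.single i 1) 1) 1"

fun somos4_iter :: "'a::field \<Rightarrow> 'a \<Rightarrow> 'a \<Rightarrow> 'a \<Rightarrow> 'a \<Rightarrow> 'a \<Rightarrow> nat \<Rightarrow> 'a" where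
  "somos4_iter \<alpha> \<beta> a b c d 0 = a"
| "somos4_iter \<alpha> \<beta> a b c d (Suc 0) = b"
| "somos4_iter \<alpha> \<beta> a b c d (Suc (Suc 0)) = c"
| "somos4_iter \<alpha> \<beta> a b c d (Suc (Suc (Suc 0))) = d"
| "somos4_iter \<alpha> \<beta> a b c d (Suc (Suc (Suc (Suc n)))) =
     (\<alpha> * somos4_iter \<alpha> \<beta> a b c d (Suc (Suc (Suc n))) * somos4_iter \<alpha> \<beta> a b c d (Suc n)
      + \<beta> * (somos4_iter \<alpha> \<beta> a b c d (Suc (Suc n)))\<^sup>2) / somos4_iter \<alpha> \<beta> a b c d n"

text \<open>The recurrence is invariant under reversal of the sequence, so iterating it backwards from
  \<open>X1, X2, X3, X4\<close> is iterating it forwards from \<open>X4, X3, X2, X1\<close>. All divisions are by nonzero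
  rational functions, since no subtraction ever occurs.\<close>

definition somos4_formal :: "int \<Rightarrow> ratfun" where
  "somos4_formal n =
     (if n \<ge> 1
      then somos4_iter (indet_fun Alpha) (indet_fun Beta)
             (indet_fun X1) (indet_fun X2) (indet_fun X3) (indet_fun X4) (nat (n - 1))
      else somos4_iter (indet_fun Alpha) (indet_fun Beta)
             (indet_fun X4) (indet_fun X3) (indet_fun X2) (indet_fun X1) (nat (4 - n)))"

definition somos4 ::
  "complex \<Rightarrow> complex \<Rightarrow> complex \<Rightarrow> complex \<Rightarrow> complex \<Rightarrow> complex \<Rightarrow> int \<Rightarrow> complex" where
  "somos4 \<alpha> \<beta> A\<^sub>1 A\<^sub>2 A\<^sub>3 A\<^sub>4 n =
     ratfun_value (somos4_formal n)
       (case_indet \<alpha> \<beta> A\<^sub>1 A\<^sub>2 A\<^sub>3 A\<^sub>4)"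

end

theory Submission
  imports Defs
begin

text \<open>
The quantity that carries the proof is \<open>f\<^sub>n = A\<^sub>n\<^sub>+\<^sub>1 A\<^sub>n\<^sub>-\<^sub>1 / A\<^sub>n\<^sup>2\<close>. The recurrence says
\<open>f\<^sub>n\<^sub>+\<^sub>1 f\<^sub>n\<^sup>2 f\<^sub>n\<^sub>-\<^sub>1 = \<alpha> f\<^sub>n + \<beta>\<close>, and \<open>T\<close> is a first integral of this map: consecutive values
lie on the curve \<open>f\<^sup>2 f'\<^sup>2 + \<alpha> (f + f') + \<beta> = T f f'\<close>. On that elliptic curve a step of the
sequence is translation by a fixed point \<open>Q\<close>, and the division polynomials of \<open>Q\<close> form an elliptic
divisibility sequence \<open>W\<close> with \<open>W\<^sub>1 = 1\<close>, \<open>W\<^sub>2\<^sup>2 = \<alpha>\<close>, \<open>W\<^sub>3 = - \<beta>\<close>, \<open>W\<^sub>4 = - (\<alpha>\<^sup>2 + \<beta> T) W\<^sub>2\<close>, which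
itself satisfies the same Somos 4 recurrence with the same \<open>T\<close>. The addition formulas of sigma
functions become
\<open>A(n + m) A(n - m) = W(m)\<^sup>2 A(n + 1) A(n - 1) - W(m + 1) W(m - 1) A(n)\<^sup>2\<close> and
\<open>W(2) A(n + m + 1) A(n - m) = W(m + 1) W(m) A(n + 2) A(n - 1) - W(m + 2) W(m - 1) A(n + 1) A(n)\<close>.

If \<open>n - m = 1\<close>, these (the second one after division by \<open>W\<^sub>2\<close>) express
\<open>A\<^sub>1 A\<^sub>N\<close>, \<open>N \<ge> 5\<close>, through terms of smaller index and products of terms of \<open>W\<close>.
The only division is by \<open>A\<^sub>1\<close>, so the theorem follows by induction once the coefficients are
known to lie in \<open>\<int>[\<alpha>, \<beta>, \<alpha>\<^sup>2 + \<beta> T]\<close>; this follows from the same formulas with \<open>A = W\<close>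
(\<open>companion_in_subring\<close>, \<open>somos4_in_subring\<close>).

The addition formulas (\<open>addition_formulas\<close>) are proved by induction on \<open>m\<close>: multiplying the left-hand
sides of two neighbouring formulas of one kind and regrouping the four factors gives those of two
neighbouring formulas of the other kind. That the right-hand sides agree as well is an identity in at
most five consecutive terms of \<open>A\<close> and of \<open>W\<close>, and a combination of the recurrence and the invariant
of the two sequences (\<open>even_step_identity\<close>, \<open>odd_step_identity\<close>).

All this requires every term of \<open>A\<close> and every \<open>W\<^sub>n\<close>, \<open>n > 0\<close>, to be nonzero, so it is carried out for
indeterminate data. Nonvanishing is seen at the point \<open>\<alpha> = 4\<close>, \<open>\<beta> = -3\<close>, \<open>A\<^sub>1 = \<dots> = A\<^sub>4 = 1\<close>, where
the curve degenerates, \<open>A\<^sub>n = 1\<close> and \<open>W\<^sub>n = n\<close>. The conclusion is transported to the given data by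
taking as the ambient ring the set of those rational functions whose value at the data exists and
lies in \<open>\<int>[\<alpha>, \<beta>, I, A\<^sub>1\<^sup>\<plusminus>\<^sup>1, A\<^sub>2, A\<^sub>3, A\<^sub>4]\<close>.
\<close>

section \<open>Somos 4 sequences with weights of period two\<close>

text \<open>The sequence \<open>W\<close> involves a square root of \<open>\<alpha>\<close>. To stay in the given field, a Somos 4 sequence
\<open>B\<close> is represented as \<open>B\<^sub>i = r\<^sub>i A\<^sub>i\<close> where \<open>r\<close> has period 2 and only \<open>d\<^sub>i = r\<^sub>i\<^sup>2\<close> need lie in the field: in
every relation between products \<open>B\<^sub>i B\<^sub>j\<close> the roots occur as \<open>d\<^sub>i\<close> or as the common factor \<open>r\<^sub>0 r\<^sub>1\<close>. The
constant weight \<open>d = 1\<close> gives ordinary Somos 4 sequences.\<close>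
locale twisted_somos4 =
  fixes \<alpha> \<beta> T :: "'a :: field" and d A :: "nat \<Rightarrow> 'a"
  assumes A_nonzero: "A i \<noteq> 0" and d_nonzero: "d i \<noteq> 0" and d_periodic: "d (i + 2) = d i"
    and recurrence:
      "d i * A (i + 4) * A i = \<alpha> * d (i + 1) * A (i + 3) * A (i + 1) + \<beta> * d i * A (i + 2) ^ 2"
    and initial_invariant:
      "T * d 0 * d 1 * A 0 * A 1 * A 2 * A 3 =
        d 0 * d 1 * (A 0 ^ 2 * A 3 ^ 2 + \<beta> * A 1 ^ 2 * A 2 ^ 2)
        + \<alpha> * (d 1 ^ 2 * A 1 ^ 3 * A 3 + d 0 ^ 2 * A 0 * A 2 ^ 3)"
begin

abbreviation invariant4 :: "nat \<Rightarrow> bool" where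
  "invariant4 i \<equiv> T * d i * d (i + 1) * A i * A (i + 1) * A (i + 2) * A (i + 3) =
        d i * d (i + 1) * (A i ^ 2 * A (i + 3) ^ 2 + \<beta> * A (i + 1) ^ 2 * A (i + 2) ^ 2)
        + \<alpha> * (d (i + 1) ^ 2 * A (i + 1) ^ 3 * A (i + 3) + d i ^ 2 * A i * A (i + 2) ^ 3)"

text \<open>The first integral in a form that spans five terms: it is the sum of the two roots
\<open>f\<^sub>n\<^sub>+\<^sub>1 + f\<^sub>n\<^sub>-\<^sub>1 = (T f\<^sub>n - \<alpha>) / f\<^sub>n\<^sup>2\<close> of the quadratic equation that \<open>invariant4\<close> gives for the neighbours
of \<open>f\<^sub>n\<close>, whereas the recurrence is their product. The passage \<open>invariant4 i\<close> to \<open>invariant5 i\<close> to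
\<open>invariant4 (i + 1)\<close> is thus the exchange of one root for the other.\<close>
abbreviation invariant5 :: "nat \<Rightarrow> bool" where
  "invariant5 i \<equiv> T * d (i + 1) * A (i + 1) * A (i + 2) * A (i + 3) =
        \<alpha> * d i * A (i + 2) ^ 3
        + d (i + 1) * (A (i + 3) ^ 2 * A i + A (i + 4) * A (i + 1) ^ 2)"

lemma invariant5_if_invariant4:
  assumes "invariant4 i"
  shows "invariant5 i"
proof -
  define a b c y z p q where abb: "a = A i" "b = A (i + 1)" "c = A (i + 2)" "y = A (i + 3)"
    "z = A (i + 4)" "p = d i" "q = d (i + 1)"
  have r: "p * z * a = \<alpha> * q * y * b + \<beta> * p * c ^ 2"
    using recurrence[of i] by (simp add: abb)
  have t: "T * p * q * a * b * c * y = p * q * (a ^ 2 * y ^ 2 + \<beta> * b ^ 2 * c ^ 2)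
      + \<alpha> * (q ^ 2 * b ^ 3 * y + p ^ 2 * a * c ^ 3)"
    using assms by (simp add: abb)
  have "p * a * (T * q * b * c * y) - p * a * (\<alpha> * p * c ^ 3 + q * (y ^ 2 * a + z * b ^ 2)) = 
     (T * p * q * a * b * c * y - (p * q * (a ^ 2 * y ^ 2 + \<beta> * b ^ 2 * c ^ 2)
      + \<alpha> * (q ^ 2 * b ^ 3 * y + p ^ 2 * a * c ^ 3)))
     - q * b ^ 2 * (p * z * a - (\<alpha> * q * y * b + \<beta> * p * c ^ 2))"
    by (simp add: algebra_simps power2_eq_square power3_eq_cube)
  hence "p * a * (T * q * b * c * y) = p * a * (\<alpha> * p * c ^ 3 + q * (y ^ 2 * a + z * b ^ 2))"
    unfolding r t by simp
  moreover have "p * a \<noteq> 0" by (simp add: abb A_nonzero d_nonzero)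
  ultimately show ?thesis by (simp add: abb)
qed

lemma invariant4_step:
  assumes "invariant5 i"
  shows "invariant4 (i + 1)"
proof -
  define a b c y z p q where abb: "a = A i" "b = A (i + 1)" "c = A (i + 2)" "y = A (i + 3)"
    "z = A (i + 4)" "p = d i" "q = d (i + 1)"
  have r: "p * z * a = \<alpha> * q * y * b + \<beta> * p * c ^ 2"
    using recurrence[of i] by (simp add: abb)
  have t: "T * q * b * c * y = \<alpha> * p * c ^ 3 + q * (y ^ 2 * a + z * b ^ 2)"
    using assms by (simp add: abb)
  have "T * q * p * b * c * y * z - (q * p * (b ^ 2 * z ^ 2 + \<beta> * c ^ 2 * y ^ 2)
      + \<alpha> * (p ^ 2 * c ^ 3 * z + q ^ 2 * b * y ^ 3)) =
     p * z * (T * q * b * c * y - (\<alpha> * p * c ^ 3 + q * (y ^ 2 * a + z * b ^ 2)))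
     + q * y ^ 2 * (p * z * a - (\<alpha> * q * y * b + \<beta> * p * c ^ 2))"
    by (simp add: algebra_simps power2_eq_square power3_eq_cube)
  hence "T * q * p * b * c * y * z = q * p * (b ^ 2 * z ^ 2 + \<beta> * c ^ 2 * y ^ 2)
      + \<alpha> * (p ^ 2 * c ^ 3 * z + q ^ 2 * b * y ^ 3)"
    unfolding r t by simp
  then show ?thesis using d_periodic[of i] by (simp add: abb eval_nat_numeral)
qed

lemma invariant4: "invariant4 i"
proof (induction i)
  case 0
  then show ?case using initial_invariant by (simp add: eval_nat_numeral)
next
  case (Suc i)
  then show ?case using invariant4_step[OF invariant5_if_invariant4[OF Suc.IH]] by simp
qed

lemma invariant5: "invariant5 i"
  using invariant5_if_invariant4 invariant4 .

lemma d_adjacent: "d (i + m) * d (i + m + 1) = d i * d (i + 1)"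
  by (induction m) (use d_periodic in \<open>auto simp: mult.commute\<close>)

end

text \<open>The products of neighbouring addition formulas agree. Here \<open>x, a, b, c, y\<close> stand for consecutive terms
of the sequence with alternating weights \<open>\<delta>, \<delta>', \<delta>, \<dots>\<close>, and \<open>v0, \<dots>, v3\<close> for consecutive terms of
the companion with weights \<open>e', e, e', e\<close>. After division by \<open>\<delta>\<^sup>2 b\<^sup>4\<close> both sides are quadratic
polynomials in \<open>f = \<delta>' c a / (\<delta> b\<^sup>2)\<close>; the hypotheses \<open>S\<close> and \<open>J\<close> are what is needed to eliminate \<open>x\<close> and \<open>y\<close>,
and \<open>V\<close> is equality of the coefficients of \<open>f\<close>.\<close>
lemma even_step_identity:
  fixes \<alpha> \<beta> T :: "'a :: field"
  assumes S: "\<delta> * y * x = \<alpha> * \<delta>' * c * a + \<beta> * \<delta> * b ^ 2"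
    and J: "T * \<delta>' * a * b * c = \<alpha> * \<delta> * b ^ 3 + \<delta>' * (c ^ 2 * x + y * a ^ 2)"
    and E: "\<alpha> = e * e'"
    and V: "e ^ 2 * v1 ^ 3 * v3 + e' ^ 2 * v2 ^ 3 * v0 + \<beta> * v2 ^ 2 * v1 ^ 2 + v3 ^ 2 * v0 ^ 2
            = T * v0 * v1 * v2 * v3"
  shows "\<delta> * \<delta>' * (v2 * v1 * y * a - v3 * v0 * c * b) * (v2 * v1 * c * x - v3 * v0 * b * a) =
    (e * v1 ^ 2 * \<delta>' * c * a - e' * v2 * v0 * \<delta> * b ^ 2)
    * (e' * v2 ^ 2 * \<delta>' * c * a - e * v3 * v1 * \<delta> * b ^ 2)" (is "?L = ?R")
proof -
  have "?L - ?R = (v2 * v1) ^ 2 * \<delta>' * c * a * (\<delta> * y * x - (\<alpha> * \<delta>' * c * a + \<beta> * \<delta> * b ^ 2))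
     + v2 * v1 * v3 * v0 * \<delta> * b * (T * \<delta>' * a * b * c - (\<alpha> * \<delta> * b ^ 3 + \<delta>' * (c ^ 2 * x + y * a ^ 2)))
     + \<delta> * \<delta>' * a * c * b ^ 2 * (e ^ 2 * v1 ^ 3 * v3 + e' ^ 2 * v2 ^ 3 * v0 + \<beta> * v2 ^ 2 * v1 ^ 2 + v3 ^ 2 * v0 ^ 2 - T * v0 * v1 * v2 * v3)"
    unfolding E by (simp add: algebra_simps power2_eq_square power3_eq_cube)
  also have "\<dots> = 0" unfolding S J V by simp
  finally show ?thesis by simp
qed

text \<open>The counterpart with the two kinds of formulas exchanged; the companion now has weights
\<open>e, e', e, e', e\<close>. After division by \<open>\<delta> \<delta>' b\<^sup>2 c\<^sup>2\<close> both sides are polynomials in \<open>f f' = a y / (b c)\<close> once \<open>f + f'\<close> is eliminated by the invariant \<open>J\<close>; the hypotheses \<open>S\<close> and \<open>V\<close> are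
equality of the constant and of the linear coefficients.\<close>
lemma odd_step_identity:
  fixes \<alpha> \<beta> T :: "'a :: field"
  assumes J: "T * \<delta>' * \<delta> * a * b * c * y = \<delta>' * \<delta> * (a ^ 2 * y ^ 2 + \<beta> * b ^ 2 * c ^ 2)
        + \<alpha> * (\<delta> ^ 2 * b ^ 3 * y + \<delta>' ^ 2 * a * c ^ 3)"
    and E: "\<alpha> = e * e'"
    and S: "v4 * v0 = e' ^ 2 * v3 * v1 + \<beta> * v2 ^ 2"
    and V: "T * v1 * v2 * v3 = e ^ 2 * v2 ^ 3 + v3 ^ 2 * v0 + v4 * v1 ^ 2"
  shows "\<delta> * \<delta>' * (v3 * v2 * y * a - v4 * v1 * c * b) * (v2 * v1 * y * a - v3 * v0 * c * b) =
    (e * v2 ^ 2 * \<delta>' * c * a - e' * v3 * v1 * \<delta> * b ^ 2)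
    * (e * v2 ^ 2 * \<delta> * y * b - e' * v3 * v1 * \<delta>' * c ^ 2)" (is "?L = ?R")
proof -
  have "?L - ?R = - (v2 ^ 2 * v1 * v3) * (T * \<delta>' * \<delta> * a * b * c * y - (\<delta>' * \<delta> * (a ^ 2 * y ^ 2 + \<beta> * b ^ 2 * c ^ 2)
        + \<alpha> * (\<delta> ^ 2 * b ^ 3 * y + \<delta>' ^ 2 * a * c ^ 3)))
     + \<delta> * \<delta>' * b ^ 2 * c ^ 2 * v1 * v3 * (v4 * v0 - (e' ^ 2 * v3 * v1 + \<beta> * v2 ^ 2))
     + \<delta> * \<delta>' * a * b * c * y * v2 * (T * v1 * v2 * v3 - (e ^ 2 * v2 ^ 3 + v3 ^ 2 * v0 + v4 * v1 ^ 2))"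
    unfolding E by (simp add: algebra_simps power2_eq_square power3_eq_cube)
  also have "\<dots> = 0" unfolding S J V by simp
  finally show ?thesis by simp
qed

section \<open>Sets closed under the ring operations\<close>

locale ring_closed_set =
  fixes S :: "'a :: comm_ring_1 set"
  assumes one: "1 \<in> S"
    and add: "x \<in> S \<Longrightarrow> y \<in> S \<Longrightarrow> x + y \<in> S"
    and uminus: "x \<in> S \<Longrightarrow> - x \<in> S"
    and mult: "x \<in> S \<Longrightarrow> y \<in> S \<Longrightarrow> x * y \<in> S"
begin

lemma diff: "x \<in> S \<Longrightarrow> y \<in> S \<Longrightarrow> x - y \<in> S"
  using add[of x "- y"] uminus by simp

lemma zero: "0 \<in> S"
  using diff[OF one one] by simp

lemma power: "x \<in> S \<Longrightarrow> x ^ n \<in> S"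
  by (induction n) (simp_all add: one mult)

lemmas closed = one zero add uminus diff mult power

end

section \<open>The companion elliptic divisibility sequence and the addition formulas\<close>

definition parity_weight :: "'a :: field \<Rightarrow> nat \<Rightarrow> 'a" where
  "parity_weight \<alpha> n = (if even n then \<alpha> else 1)"

text \<open>The elliptic divisibility sequence \<open>W\<close> with the root removed: the value at \<open>n\<close> is \<open>W\<^sub>n\<close> for odd \<open>n\<close> and
\<open>W\<^sub>n / W\<^sub>2\<close> for even \<open>n\<close>, so that \<open>W\<^sub>n\<^sup>2\<close> is \<open>parity_weight \<alpha> n\<close> times its square. The recursive
equation is the Somos 4 recurrence of \<open>W\<close> in this normalisation; \<open>I\<close> will be \<open>\<alpha>\<^sup>2 + \<beta> T\<close>.\<close>
fun companion_eds :: "'a :: field \<Rightarrow> 'a \<Rightarrow> 'a \<Rightarrow> nat \<Rightarrow> 'a" where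
  "companion_eds \<alpha> \<beta> I 0 = 0"
| "companion_eds \<alpha> \<beta> I (Suc 0) = 1"
| "companion_eds \<alpha> \<beta> I (Suc (Suc 0)) = 1"
| "companion_eds \<alpha> \<beta> I (Suc (Suc (Suc 0))) = - \<beta>"
| "companion_eds \<alpha> \<beta> I (Suc (Suc (Suc (Suc 0)))) = - I"
| "companion_eds \<alpha> \<beta> I (Suc (Suc (Suc (Suc (Suc n))))) =
     ((parity_weight \<alpha> n) ^ 2 * companion_eds \<alpha> \<beta> I (Suc (Suc (Suc (Suc n)))) * companion_eds \<alpha> \<beta> I (Suc (Suc n))
      + \<beta> * companion_eds \<alpha> \<beta> I (Suc (Suc (Suc n))) ^ 2) / companion_eds \<alpha> \<beta> I (Suc n)"

text \<open>The recursion of \<open>companion_eds\<close> divides by earlier terms, so its equations say what they are meant to say as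
long as no term of positive index vanishes.\<close>
locale somos4_companion =
  fixes \<alpha> \<beta> T :: "'a :: field"
  assumes \<alpha>_nonzero: "\<alpha> \<noteq> 0"
    and companion_nonzero: "n > 0 \<Longrightarrow> companion_eds \<alpha> \<beta> (\<alpha> ^ 2 + \<beta> * T) n \<noteq> 0"
begin

abbreviation "e \<equiv> parity_weight \<alpha>"

definition V :: "nat \<Rightarrow> 'a" where
  "V = companion_eds \<alpha> \<beta> (\<alpha> ^ 2 + \<beta> * T)"

lemma V_nonzero: "n > 0 \<Longrightarrow> V n \<noteq> 0"
  by (simp add: V_def companion_nonzero)

lemma e_simps [simp]:
  "e (Suc (Suc n)) = e n" "e (n + 2) = e n" "e (n + 3) = e (n + 1)" "e (n + 4) = e n" "e (n + 5) = e (n + 1)"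
  by (auto simp: parity_weight_def)

lemma e_1: "e 1 = 1"
  by (simp add: parity_weight_def)

lemma e_nonzero [simp]: "e n \<noteq> 0"
  by (simp add: parity_weight_def \<alpha>_nonzero)

lemma \<alpha>_eq: "\<alpha> = e n * e (n + 1)"
  by (simp add: parity_weight_def)

lemma V_small: "V 0 = 0" "V 1 = 1" "V 2 = 1" "V 3 = - \<beta>" "V 4 = - (\<alpha> ^ 2 + \<beta> * T)"
  by (simp_all add: V_def eval_nat_numeral)

lemma V_small_Suc [simp]:
  "V (Suc 0) = 1" "V (Suc (Suc 0)) = 1" "V (Suc (Suc (Suc 0))) = - \<beta>"
  by (simp_all add: V_def)

lemma V_recurrence: "V (k + 4) * V k = e (k + 1) ^ 2 * V (k + 3) * V (k + 1) + \<beta> * V (k + 2) ^ 2"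
proof (cases k)
  case 0
  then show ?thesis using V_small by (simp add: parity_weight_def)
next
  case (Suc j)
  then show ?thesis using companion_nonzero[of "Suc j"] by (simp add: V_def eval_nat_numeral)
qed

text \<open>The companion is a twisted Somos 4 sequence with the same \<open>\<alpha>\<close>, \<open>\<beta>\<close>, \<open>T\<close>. It is shifted by one because
\<open>V 0 = 0\<close>. That \<open>T\<close> is its invariant is what forces the value of \<open>V 4\<close>.\<close>
sublocale shifted: twisted_somos4 \<alpha> \<beta> T "\<lambda>i. e (i + 1)" "\<lambda>i. V (i + 1)"
proof
  fix i
  show "V (i + 1) \<noteq> 0" "e (i + 1) \<noteq> 0" "e (i + 2 + 1) = e (i + 1)"
    by (simp_all add: V_nonzero)
  have "e (i + 1) * (V (i + 5) * V (i + 1)) = 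
      e (i + 1) * (e (i + 2) ^ 2 * V (i + 4) * V (i + 2) + \<beta> * V (i + 3) ^ 2)"
    using V_recurrence[of "i + 1"] by (simp add: eval_nat_numeral)
  also have "\<dots> = (e (i + 1) * e (i + 1 + 1)) * e (i + 2) * V (i + 4) * V (i + 2) + \<beta> * e (i + 1) * V (i + 3) ^ 2"
    by (simp add: algebra_simps power2_eq_square)
  finally show "e (i + 1) * V (i + 4 + 1) * V (i + 1) =
      \<alpha> * e (i + 1 + 1) * V (i + 3 + 1) * V (i + 1 + 1) + \<beta> * e (i + 1) * V (i + 2 + 1) ^ 2"
    unfolding \<alpha>_eq[of "i + 1", symmetric] by (simp add: eval_nat_numeral mult.assoc)
next
  show "T * e (0 + 1) * e (1 + 1) * V (0 + 1) * V (1 + 1) * V (2 + 1) * V (3 + 1) =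
      e (0 + 1) * e (1 + 1) * (V (0 + 1) ^ 2 * V (3 + 1) ^ 2 + \<beta> * V (1 + 1) ^ 2 * V (2 + 1) ^ 2)
      + \<alpha> * (e (1 + 1) ^ 2 * V (1 + 1) ^ 3 * V (3 + 1) + e (0 + 1) ^ 2 * V (0 + 1) * V (2 + 1) ^ 3)"
    by (simp add: V_small parity_weight_def algebra_simps power2_eq_square power3_eq_cube)
qed

text \<open>The invariants of the companion extend to windows that begin at the zero \<open>V 0\<close>, where they are
checked directly; elsewhere they are those of the shifted sequence with the common weights cancelled.\<close>
lemma V_invariant5:
  "T * V (k + 1) * V (k + 2) * V (k + 3) =
    e k ^ 2 * V (k + 2) ^ 3 + V (k + 3) ^ 2 * V k + V (k + 4) * V (k + 1) ^ 2"
proof (cases k)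
  case 0
  then show ?thesis using V_small by (simp add: parity_weight_def algebra_simps)
next
  case (Suc i)
  have "e i * (T * V (i + 2) * V (i + 3) * V (i + 4)) =
     \<alpha> * e (i + 1) * V (i + 3) ^ 3 + e i * (V (i + 4) ^ 2 * V (i + 1) + V (i + 5) * V (i + 2) ^ 2)"
    using shifted.invariant5[of i] by (simp add: eval_nat_numeral mult_ac)
  also have "\<alpha> * e (i + 1) * V (i + 3) ^ 3 = e i * (e (i + 1) ^ 2 * V (i + 3) ^ 3)"
  proof -
    have "e i * (e (i + 1) ^ 2 * V (i + 3) ^ 3) = (e i * e (i + 1)) * e (i + 1) * V (i + 3) ^ 3"
      by (simp only: power2_eq_square mult.assoc)
    then show ?thesis unfolding \<alpha>_eq[of i, symmetric] ..
  qed
  also have "e i * (e (i + 1) ^ 2 * V (i + 3) ^ 3)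
      + e i * (V (i + 4) ^ 2 * V (i + 1) + V (i + 5) * V (i + 2) ^ 2) =
     e i * (e (i + 1) ^ 2 * V (i + 3) ^ 3 + V (i + 4) ^ 2 * V (i + 1) + V (i + 5) * V (i + 2) ^ 2)"
    by (simp only: distrib_left add.assoc)
  finally show ?thesis using Suc by (simp add: eval_nat_numeral)
qed

lemma V_invariant4:
  "e (k + 1) ^ 2 * V (k + 1) ^ 3 * V (k + 3) + e k ^ 2 * V (k + 2) ^ 3 * V k
     + \<beta> * V (k + 2) ^ 2 * V (k + 1) ^ 2 + V (k + 3) ^ 2 * V k ^ 2 =
   T * V k * V (k + 1) * V (k + 2) * V (k + 3)"
proof (cases k)
  case 0
  then show ?thesis using V_small by (simp add: parity_weight_def)
next
  case (Suc i)
  have "e (i + 1) * e (i + 2) * (T * V (i + 1) * V (i + 2) * V (i + 3) * V (i + 4)) =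
     e (i + 1) * e (i + 2) * (V (i + 1) ^ 2 * V (i + 4) ^ 2 + \<beta> * V (i + 2) ^ 2 * V (i + 3) ^ 2)
       + \<alpha> * (e i ^ 2 * V (i + 2) ^ 3 * V (i + 4) + e (i + 1) ^ 2 * V (i + 1) * V (i + 3) ^ 3)"
    using shifted.invariant4[of i] by (simp add: eval_nat_numeral mult_ac)
  moreover have "e (i + 1) * e (i + 2) = \<alpha>" using \<alpha>_eq[of "i + 1"] by (simp add: add.assoc)
  ultimately have "\<alpha> * (T * V (i + 1) * V (i + 2) * V (i + 3) * V (i + 4)) =
     \<alpha> * (V (i + 1) ^ 2 * V (i + 4) ^ 2 + \<beta> * V (i + 2) ^ 2 * V (i + 3) ^ 2
       + (e i ^ 2 * V (i + 2) ^ 3 * V (i + 4) + e (i + 1) ^ 2 * V (i + 1) * V (i + 3) ^ 3))"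
    by (metis distrib_left)
  hence "T * V (i + 1) * V (i + 2) * V (i + 3) * V (i + 4) =
     V (i + 1) ^ 2 * V (i + 4) ^ 2 + \<beta> * V (i + 2) ^ 2 * V (i + 3) ^ 2
       + (e i ^ 2 * V (i + 2) ^ 3 * V (i + 4) + e (i + 1) ^ 2 * V (i + 1) * V (i + 3) ^ 3)"
    using \<alpha>_nonzero by simp
  then show ?thesis using Suc by (simp add: eval_nat_numeral algebra_simps)
qed

text \<open>In the notation with \<open>n\<close> and \<open>m\<close>, here \<open>i = n - m\<close> and \<open>k = m - 1\<close>; as \<open>m\<close> starts at 1, the companion
is taken at nonnegative indices and the induction starts with trivial identities. In the induction step the formula of even kind is obtained from two
formulas of odd kind, whose product contains it together with the previous formula of even kind, which
is cancelled; then the formula of odd kind is obtained in the same way from two of even kind.\<close>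
lemma addition_formulas:
  assumes "twisted_somos4 \<alpha> \<beta> T d A"
  shows "d i * A (i + 2 * k + 2) * A i =
           e (k + 1) * V (k + 1) ^ 2 * d (i + k) * A (i + k + 2) * A (i + k)
           - e k * V (k + 2) * V k * d (i + k + 1) * A (i + k + 1) ^ 2" (is "?even i k")
    and "A (i + 2 * k + 3) * A i =
           V (k + 2) * V (k + 1) * A (i + k + 3) * A (i + k)
           - V (k + 3) * V k * A (i + k + 2) * A (i + k + 1)" (is "?odd i k")
proof -
  interpret A: twisted_somos4 \<alpha> \<beta> T d A by fact
  have "(\<forall>i. ?even i k) \<and> (\<forall>i. ?odd i k)"
  proof (induction k)
    case 0
    then show ?case using V_small by (simp add: parity_weight_def numeral_2_eq_2)
  next
    case (Suc k)
    define v0 v1 v2 v3 v4 where V: "v0 = V k" "v1 = V (k + 1)" "v2 = V (k + 2)"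
      "v3 = V (k + 3)" "v4 = V (k + 4)"
    have even_Suc: "?even i (Suc k)" for i
    proof -
      define x a b c y \<delta> \<delta>' where X: "x = A (i + k)" "a = A (i + k + 1)" "b = A (i + k + 2)"
        "c = A (i + k + 3)" "y = A (i + k + 4)" "\<delta> = d (i + k)" "\<delta>' = d (i + k + 1)"
      have 1: "A (i + 2 * k + 4) * A (i + 1) = v2 * v1 * y * a - v3 * v0 * c * b"
        using Suc.IH[THEN conjunct2, THEN spec, of "i + 1"] by (simp add: X V eval_nat_numeral)
      have 2: "A (i + 2 * k + 3) * A i = v2 * v1 * c * x - v3 * v0 * b * a"
        using Suc.IH[THEN conjunct2, THEN spec, of i] by (simp add: X V)
      have 3: "d (i + 1) * A (i + 2 * k + 3) * A (i + 1) =
          e (k + 1) * v1 ^ 2 * \<delta>' * c * a - e k * v2 * v0 * \<delta> * b ^ 2"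
        using Suc.IH[THEN conjunct1, THEN spec, of "i + 1"] A.d_periodic[of "i + k"]
        by (simp add: X V eval_nat_numeral)
      have 4: "\<delta> * \<delta>' = d i * d (i + 1)"
        using A.d_adjacent[of i k] by (simp add: X)
      \<comment> \<open>Odd formulas \<open>1\<close> and \<open>2\<close> multiply to the known even formula \<open>3\<close> times the wanted one.\<close>
      have "(d (i + 1) * A (i + 2 * k + 3) * A (i + 1)) * (d i * A (i + 2 * k + 4) * A i) =
        \<delta> * \<delta>' * (A (i + 2 * k + 4) * A (i + 1)) * (A (i + 2 * k + 3) * A i)"
        unfolding 4 by (simp add: mult_ac)
      also have "\<dots> = (e (k + 1) * v1 ^ 2 * \<delta>' * c * a - e k * v2 * v0 * \<delta> * b ^ 2)
         * (e k * v2 ^ 2 * \<delta>' * c * a - e (k + 1) * v3 * v1 * \<delta> * b ^ 2)"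
        unfolding 1 2
      proof (rule even_step_identity)
        show "\<delta> * y * x = \<alpha> * \<delta>' * c * a + \<beta> * \<delta> * b ^ 2"
          using A.recurrence[of "i + k"] by (simp add: X)
        show "T * \<delta>' * a * b * c = \<alpha> * \<delta> * b ^ 3 + \<delta>' * (c ^ 2 * x + y * a ^ 2)"
          using A.invariant5[of "i + k"] by (simp add: X)
        show "\<alpha> = e (k + 1) * e k" using \<alpha>_eq[of k] by (simp add: mult.commute)
        show "e (k + 1) ^ 2 * v1 ^ 3 * v3 + e k ^ 2 * v2 ^ 3 * v0 + \<beta> * v2 ^ 2 * v1 ^ 2 + v3 ^ 2 * v0 ^ 2
            = T * v0 * v1 * v2 * v3"
          using V_invariant4[of k] by (simp add: V)
      qed
      also have "\<dots> = (d (i + 1) * A (i + 2 * k + 3) * A (i + 1)) *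
         (e k * v2 ^ 2 * \<delta>' * c * a - e (k + 1) * v3 * v1 * \<delta> * b ^ 2)"
        unfolding 3 ..
      finally have "d i * A (i + 2 * k + 4) * A i =
          e k * v2 ^ 2 * \<delta>' * c * a - e (k + 1) * v3 * v1 * \<delta> * b ^ 2"
        using A.A_nonzero A.d_nonzero by (simp only: mult_cancel_left mult_eq_0_iff) simp
      then show ?thesis using A.d_periodic[of "i + k"] by (simp add: X V eval_nat_numeral)
    qed
    have "?odd i (Suc k)" for i
    proof -
      define a b c y \<delta> \<delta>' where X: "a = A (i + k + 1)" "b = A (i + k + 2)"
        "c = A (i + k + 3)" "y = A (i + k + 4)" "\<delta> = d (i + k)" "\<delta>' = d (i + k + 1)"
      have per: "d (i + k + 2) = \<delta>" "d (i + k + 3) = \<delta>'" 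
        using A.d_periodic[of "i + k"] A.d_periodic[of "i + k + 1"] by (simp_all add: X eval_nat_numeral)
      have 1: "A (i + 2 * k + 4) * A (i + 1) = v2 * v1 * y * a - v3 * v0 * c * b"
        using Suc.IH[THEN conjunct2, THEN spec, of "i + 1"] by (simp add: X V eval_nat_numeral)
      have 2: "d i * A (i + 2 * k + 4) * A i = e k * v2 ^ 2 * \<delta>' * c * a - e (k + 1) * v3 * v1 * \<delta> * b ^ 2"
        using even_Suc[of i] per by (simp add: X V eval_nat_numeral)
      have 3: "d (i + 1) * A (i + 2 * k + 5) * A (i + 1) =
          e k * v2 ^ 2 * \<delta> * y * b - e (k + 1) * v3 * v1 * \<delta>' * c ^ 2"
        using even_Suc[of "i + 1"] per by (simp add: X V eval_nat_numeral)
      have 4: "\<delta> * \<delta>' = d i * d (i + 1)"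
        using A.d_adjacent[of i k] by (simp add: X)
      \<comment> \<open>Even formulas \<open>2\<close> and \<open>3\<close> multiply to the known odd formula \<open>1\<close> times the wanted one.\<close>
      have "\<delta> * \<delta>' * (v3 * v2 * y * a - v4 * v1 * c * b) * (A (i + 2 * k + 4) * A (i + 1)) =
         (d i * A (i + 2 * k + 4) * A i) * (d (i + 1) * A (i + 2 * k + 5) * A (i + 1))"
        unfolding 1 2 3
      proof (rule odd_step_identity)
        show "T * \<delta>' * \<delta> * a * b * c * y = \<delta>' * \<delta> * (a ^ 2 * y ^ 2 + \<beta> * b ^ 2 * c ^ 2)
            + \<alpha> * (\<delta> ^ 2 * b ^ 3 * y + \<delta>' ^ 2 * a * c ^ 3)"
          using A.invariant4[of "i + k + 1"] per by (simp add: X eval_nat_numeral)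
        show "\<alpha> = e k * e (k + 1)" by (rule \<alpha>_eq)
        show "v4 * v0 = e (k + 1) ^ 2 * v3 * v1 + \<beta> * v2 ^ 2"
          using V_recurrence[of k] by (simp add: V)
        show "T * v1 * v2 * v3 = e k ^ 2 * v2 ^ 3 + v3 ^ 2 * v0 + v4 * v1 ^ 2"
          using V_invariant5[of k] by (simp add: V)
      qed
      also have "\<dots> = \<delta> * \<delta>' * (A (i + 2 * k + 5) * A i) * (A (i + 2 * k + 4) * A (i + 1))"
        unfolding 4 by (simp add: mult_ac)
      finally have "A (i + 2 * k + 5) * A i = v3 * v2 * y * a - v4 * v1 * c * b"
        using A.A_nonzero A.d_nonzero by (simp add: X)
      then show ?thesis by (simp add: X V eval_nat_numeral)
    qed
    with even_Suc show ?case by blast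
  qed
  then show "?even i k" "?odd i k" by blast+
qed

text \<open>With \<open>n - m = 1\<close> and \<open>A = V\<close> the addition formulas are the duplication formulas of the elliptic
divisibility sequence: they compute \<open>V n\<close> for \<open>n \<ge> 5\<close> from earlier terms without any division, since
\<open>V 1 = 1\<close>.\<close>
lemma companion_in_subring:
  assumes "ring_closed_set S" and "\<alpha> \<in> S" "\<beta> \<in> S" "\<alpha> ^ 2 + \<beta> * T \<in> S"
  shows "V n \<in> S"
proof (induction n rule: less_induct)
  case (less n)
  interpret ring_closed_set S by fact
  have e: "e j \<in> S" for j using assms by (simp add: parity_weight_def one)
  consider "n \<le> 4" | k where "n = 2 * k + 5" | k where "n = 2 * k + 6"
  proof (cases "n \<le> 4")
    case False
    have "n = 2 * ((n - 5) div 2) + 5 \<or> n = 2 * ((n - 5) div 2) + 6"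
      using False by presburger
    then show ?thesis using that by blast
  qed
  then show ?case
  proof cases
    case 1
    then consider "n = 0" | "n = 1" | "n = 2" | "n = 3" | "n = 4" by linarith
    then show ?thesis by cases (simp_all only: V_small assms closed)
  next
    case 2
    have *: "V (k + 2) \<in> S" "V (k + 3) \<in> S" "V (k + 4) \<in> S" "V (k + 1) \<in> S" 
      by (rule less.IH; use 2 in simp)+
    have "V n = e k * V (k + 2) ^ 2 * e k * V (k + 4) * V (k + 2)
      - e (k + 1) * V (k + 3) * V (k + 1) * e (k + 1) * V (k + 3) ^ 2"
      using addition_formulas(1)[OF shifted.twisted_somos4_axioms, of 0 "k + 1"] V_small(2) e_1 2
      by (simp add: eval_nat_numeral)
    then show ?thesis by (simp only:) (intro diff mult power * e)
  next
    case 3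
    have *: "V (k + 1) \<in> S" "V (k + 2) \<in> S" "V (k + 3) \<in> S" "V (k + 4) \<in> S" "V (k + 5) \<in> S" 
      by (rule less.IH; use 3 in simp)+
    have "V n = V (k + 3) * V (k + 2) * V (k + 5) * V (k + 2)
      - V (k + 4) * V (k + 1) * V (k + 4) * V (k + 3)"
      using addition_formulas(2)[OF shifted.twisted_somos4_axioms, of 0 "k + 1"] V_small 3
      by (simp add: eval_nat_numeral)
    then show ?thesis by (simp only:) (intro diff mult power *)
  qed
qed

text \<open>The addition formulas at \<open>i = 0\<close> give \<open>A n * A 0\<close> for \<open>n \<ge> 4\<close> as a polynomial in earlier terms, so
that \<open>A 0\<close> is the only term of the sequence that has to be inverted.\<close>
lemma somos4_in_subring:
  assumes A: "twisted_somos4 \<alpha> \<beta> T (\<lambda>_. 1) A"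
    and "ring_closed_set S" and "\<alpha> \<in> S" "\<beta> \<in> S" "\<alpha> ^ 2 + \<beta> * T \<in> S"
    and init: "inverse (A 0) \<in> S" "A 0 \<in> S" "A 1 \<in> S" "A 2 \<in> S" "A 3 \<in> S"
  shows "A n \<in> S"
proof (induction n rule: less_induct)
  case (less n)
  interpret ring_closed_set S by fact
  interpret A: twisted_somos4 \<alpha> \<beta> T "\<lambda>_. 1" A by fact
  have e: "e j \<in> S" for j using assms by (simp add: parity_weight_def one)
  have V: "V j \<in> S" for j using companion_in_subring[of S j] assms by blast
  have cancel: "A n \<in> S" if "A n * A 0 \<in> S"
    using mult[OF that init(1)] A.A_nonzero[of 0] by (simp add: mult.assoc)
  consider "n \<le> 3" | k where "n = 2 * k + 4" | k where "n = 2 * k + 5"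
  proof (cases "n \<le> 3")
    case False
    have "n = 2 * ((n - 4) div 2) + 4 \<or> n = 2 * ((n - 4) div 2) + 5"
      using False by presburger
    then show ?thesis using that by blast
  qed
  then show ?case
  proof cases
    case 1
    then consider "n = 0" | "n = 1" | "n = 2" | "n = 3" by linarith
    then show ?thesis by cases (simp_all only: init)
  next
    case 2
    have *: "A (k + 1) \<in> S" "A (k + 2) \<in> S" "A (k + 3) \<in> S"
      by (rule less.IH; use 2 in simp)+
    have "A n * A 0 = e k * V (k + 2) ^ 2 * A (k + 3) * A (k + 1)
      - e (k + 1) * V (k + 3) * V (k + 1) * A (k + 2) ^ 2"
      using addition_formulas(1)[OF A, of 0 "k + 1"] 2
      by (simp add: eval_nat_numeral)
    then show ?thesis by (intro cancel) (simp only:, intro diff mult power * e V)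
  next
    case 3
    have *: "A (k + 1) \<in> S" "A (k + 2) \<in> S" "A (k + 3) \<in> S" "A (k + 4) \<in> S"
      by (rule less.IH; use 3 in simp)+
    have "A n * A 0 = V (k + 3) * V (k + 2) * A (k + 4) * A (k + 1)
      - V (k + 4) * V (k + 1) * A (k + 3) * A (k + 2)"
      using addition_formulas(2)[OF A, of 0 "k + 1"] 3
      by (simp add: eval_nat_numeral)
    then show ?thesis by (intro cancel) (simp only:, intro diff mult power * V)
  qed
qed

end

section \<open>Evaluation of rational functions\<close>

lemma poly_value_superset:
  assumes "finite B" "Poly_Mapping.keys p \<subseteq> B"
  shows "poly_value x p = (\<Sum>m\<in>B. of_int (Poly_Mapping.lookup p m) *
        (\<Prod>i\<in>Poly_Mapping.keys m. x i ^ Poly_Mapping.lookup m i))"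
  unfolding poly_value_def
  by (rule sum.mono_neutral_left) (use assms in \<open>auto simp: in_keys_iff\<close>)

lemma poly_value_add: "poly_value x (p + q) = poly_value x p + poly_value x q"
proof -
  let ?B = "Poly_Mapping.keys p \<union> Poly_Mapping.keys q"
  have "finite ?B" by simp
  moreover have "Poly_Mapping.keys (p + q) \<subseteq> ?B" by (rule Poly_Mapping.keys_add)
  ultimately show ?thesis
    by (simp add: poly_value_superset[of ?B] lookup_add distrib_right sum.distrib)
qed

lemma poly_value_single:
  "poly_value x (Poly_Mapping.single m c) =
     of_int c * (\<Prod>i\<in>Poly_Mapping.keys m. x i ^ Poly_Mapping.lookup m i)"
  by (simp add: poly_value_def)

lemma poly_value_zero: "poly_value x 0 = 0"
  by (simp add: poly_value_def)

lemma poly_value_one: "poly_value x 1 = 1"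
  using poly_value_single[of x 0 1] by simp

lemma monomial_value_add:
  fixes x :: "indet \<Rightarrow> complex" and k l :: "indet \<Rightarrow>\<^sub>0 nat"
  shows "(\<Prod>i\<in>Poly_Mapping.keys (k + l). x i ^ Poly_Mapping.lookup (k + l) i) =
    (\<Prod>i\<in>Poly_Mapping.keys k. x i ^ Poly_Mapping.lookup k i)
    * (\<Prod>i\<in>Poly_Mapping.keys l. x i ^ Poly_Mapping.lookup l i)"
proof -
  let ?B = "Poly_Mapping.keys k \<union> Poly_Mapping.keys l"
  have superset: "(\<Prod>i\<in>Poly_Mapping.keys m. x i ^ Poly_Mapping.lookup m i) =
      (\<Prod>i\<in>?B. x i ^ Poly_Mapping.lookup m i)" if "Poly_Mapping.keys m \<subseteq> ?B" for m :: "indet \<Rightarrow>\<^sub>0 nat"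
    by (rule prod.mono_neutral_left) (use that in \<open>auto simp: in_keys_iff\<close>)
  show ?thesis
    unfolding superset[OF Poly_Mapping.keys_add] superset[OF Un_upper1] superset[OF Un_upper2]
    by (simp add: lookup_add power_add prod.distrib)
qed

text \<open>A polynomial is built up by adding monomials, which reduces multiplicativity of the evaluation to
the case of two monomials.\<close>
lemma int_poly_induct [case_names zero add_single]:
  fixes p :: int_poly
  assumes "P 0" and step: "\<And>p m c. P p \<Longrightarrow> P (p + Poly_Mapping.single m c)"
  shows "P p"
proof (induction p rule: update_induct)
  case (update p m c)
  have "Poly_Mapping.update m c p = p + Poly_Mapping.single m c"
    using update by (intro poly_mapping_eqI) (auto simp: lookup_update lookup_add lookup_single in_keys_iff when_def)
  then show ?case using step update by simp
qed fact

lemma poly_value_mult: "poly_value x (p * q) = poly_value x p * poly_value x q"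
proof (induction p rule: int_poly_induct)
  case (add_single p m c)
  have "poly_value x (Poly_Mapping.single m c * q) = poly_value x (Poly_Mapping.single m c) * poly_value x q"
  proof (induction q rule: int_poly_induct)
    case (add_single q l b)
    then show ?case
      by (simp add: distrib_left poly_value_add mult_single poly_value_single monomial_value_add mult_ac)
  qed (simp add: poly_value_zero)
  with add_single show ?case by (simp add: distrib_right poly_value_add)
qed (simp add: poly_value_zero)

lemma poly_value_uminus: "poly_value x (- p) = - poly_value x p"
proof -
  have "poly_value x (- p) + poly_value x p = 0"
    by (simp add: poly_value_add[symmetric] poly_value_zero)
  then show ?thesis by (simp add: eq_neg_iff_add_eq_0)
qed

lemma nonzero_if_poly_value: "poly_value x q \<noteq> 0 \<Longrightarrow> q \<noteq> 0"
  using poly_value_zero by auto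

text \<open>Cross-multiplying two representations of the same rational function gives an identity of polynomials,
which can be evaluated.\<close>
lemma has_value_at_unique:
  assumes "has_value_at r x v" "has_value_at r x w"
  shows "v = w"
proof -
  obtain p q p' q' where *: "r = Fract p q" "poly_value x q \<noteq> 0" "v = poly_value x p / poly_value x q"
    "r = Fract p' q'" "poly_value x q' \<noteq> 0" "w = poly_value x p' / poly_value x q'"
    using assms unfolding has_value_at_def by blast
  then have "p * q' = p' * q"
    using nonzero_if_poly_value eq_fract(1)[of q q' p p'] by metis
  then have "poly_value x p * poly_value x q' = poly_value x p' * poly_value x q"
    by (metis poly_value_mult)
  with * show ?thesis by (simp add: frac_eq_eq)
qed

lemma has_value_at_Fract_one: "has_value_at (Fract p 1) x (poly_value x p)"
  unfolding has_value_at_def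
  by (rule exI[of _ p], rule exI[of _ 1]) (simp add: poly_value_one)

lemma has_value_at_one: "has_value_at 1 x 1"
  using has_value_at_Fract_one[of 1 x] by (simp add: One_fract_def poly_value_one)

lemma has_value_at_zero: "has_value_at 0 x 0"
  using has_value_at_Fract_one[of 0 x] by (simp add: Zero_fract_def poly_value_zero)

lemma has_value_at_indet: "has_value_at (indet_fun i) x (x i)"
proof -
  have "poly_value x (Poly_Mapping.single (Poly_Mapping.single i 1) 1) = x i"
    by (simp add: poly_value_single)
  then show ?thesis
    using has_value_at_Fract_one[of "Poly_Mapping.single (Poly_Mapping.single i 1) 1" x]
    by (simp add: indet_fun_def)
qed

lemma has_value_at_add:
  assumes "has_value_at r x v" "has_value_at s x w"
  shows "has_value_at (r + s) x (v + w)"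
proof -
  obtain p q p' q' where *: "r = Fract p q" "poly_value x q \<noteq> 0" "v = poly_value x p / poly_value x q"
    "s = Fract p' q'" "poly_value x q' \<noteq> 0" "w = poly_value x p' / poly_value x q'"
    using assms unfolding has_value_at_def by blast
  show ?thesis unfolding has_value_at_def
    by (rule exI[of _ "p * q' + p' * q"], rule exI[of _ "q * q'"])
      (use * in \<open>simp add: nonzero_if_poly_value poly_value_add poly_value_mult add_frac_eq\<close>)
qed

lemma has_value_at_uminus:
  assumes "has_value_at r x v"
  shows "has_value_at (- r) x (- v)"
proof -
  obtain p q where *: "r = Fract p q" "poly_value x q \<noteq> 0" "v = poly_value x p / poly_value x q"
    using assms unfolding has_value_at_def by blast
  show ?thesis unfolding has_value_at_def
    by (rule exI[of _ "- p"], rule exI[of _ q]) (use * in \<open>simp add: poly_value_uminus\<close>)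
qed

lemma has_value_at_mult:
  assumes "has_value_at r x v" "has_value_at s x w"
  shows "has_value_at (r * s) x (v * w)"
proof -
  obtain p q p' q' where *: "r = Fract p q" "poly_value x q \<noteq> 0" "v = poly_value x p / poly_value x q"
    "s = Fract p' q'" "poly_value x q' \<noteq> 0" "w = poly_value x p' / poly_value x q'"
    using assms unfolding has_value_at_def by blast
  show ?thesis unfolding has_value_at_def
    by (rule exI[of _ "p * p'"], rule exI[of _ "q * q'"]) (use * in \<open>simp add: poly_value_mult\<close>)
qed

lemma has_value_at_divide:
  assumes "has_value_at r x v" "has_value_at s x w" "w \<noteq> 0"
  shows "has_value_at (r / s) x (v / w)"
proof -
  obtain p q p' q' where *: "r = Fract p q" "poly_value x q \<noteq> 0" "v = poly_value x p / poly_value x q"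
    "s = Fract p' q'" "poly_value x q' \<noteq> 0" "w = poly_value x p' / poly_value x q'"
    using assms unfolding has_value_at_def by blast
  show ?thesis unfolding has_value_at_def
    by (rule exI[of _ "p * q'"], rule exI[of _ "q * p'"])
      (use * assms(3) in \<open>auto simp: poly_value_mult\<close>)
qed

lemma has_value_at_power: "has_value_at r x v \<Longrightarrow> has_value_at (r ^ n) x (v ^ n)"
  by (induction n) (simp_all add: has_value_at_one has_value_at_mult)

lemmas has_value_at_intros = has_value_at_one has_value_at_indet has_value_at_add
  has_value_at_uminus has_value_at_mult has_value_at_divide has_value_at_power

lemma nonzero_if_has_value_at:
  assumes "has_value_at r x v" "v \<noteq> 0"
  shows "r \<noteq> 0"
  using has_value_at_unique[OF _ has_value_at_zero] assms by blast

lemma ratfun_value_eqI: "has_value_at r x v \<Longrightarrow> ratfun_value r x = v"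
  unfolding ratfun_value_def using has_value_at_unique by blast

section \<open>The sequence with indeterminate data\<close>

lemma companion_eds_4: "companion_eds \<alpha> \<beta> I 4 = - I"
  by (simp add: eval_nat_numeral)

lemma companion_shift: "companion_eds \<alpha> \<beta> I (n + 5) =
     (parity_weight \<alpha> n ^ 2 * companion_eds \<alpha> \<beta> I (n + 4) * companion_eds \<alpha> \<beta> I (n + 2)
      + \<beta> * companion_eds \<alpha> \<beta> I (n + 3) ^ 2) / companion_eds \<alpha> \<beta> I (n + 1)"
  by (simp add: eval_nat_numeral)

lemma somos4_iter_shift: "somos4_iter \<alpha> \<beta> a b c d (n + 4) =
     (\<alpha> * somos4_iter \<alpha> \<beta> a b c d (n + 3) * somos4_iter \<alpha> \<beta> a b c d (n + 1)
      + \<beta> * (somos4_iter \<alpha> \<beta> a b c d (n + 2))\<^sup>2) / somos4_iter \<alpha> \<beta> a b c d n"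
  by (simp add: eval_nat_numeral)

definition somos4_invariant :: "'a :: field \<Rightarrow> 'a \<Rightarrow> 'a \<Rightarrow> 'a \<Rightarrow> 'a \<Rightarrow> 'a \<Rightarrow> 'a" where
  "somos4_invariant \<alpha> \<beta> a b c d =
     (a ^ 2 * d ^ 2 + \<alpha> * (b ^ 3 * d + a * c ^ 3) + \<beta> * b ^ 2 * c ^ 2) / (a * b * c * d)"

lemma twisted_somos4_iter:
  assumes nz: "\<And>n. somos4_iter \<alpha> \<beta> a b c d n \<noteq> 0"
  shows "twisted_somos4 \<alpha> \<beta> (somos4_invariant \<alpha> \<beta> a b c d) (\<lambda>_. 1) (somos4_iter \<alpha> \<beta> a b c d)"
proof
  fix i
  show "1 * somos4_iter \<alpha> \<beta> a b c d (i + 4) * somos4_iter \<alpha> \<beta> a b c d i =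
    \<alpha> * 1 * somos4_iter \<alpha> \<beta> a b c d (i + 3) * somos4_iter \<alpha> \<beta> a b c d (i + 1)
    + \<beta> * 1 * (somos4_iter \<alpha> \<beta> a b c d (i + 2))\<^sup>2"
    using nz[of i] by (simp add: somos4_iter_shift)
next
  have "a \<noteq> 0" "b \<noteq> 0" "c \<noteq> 0" "d \<noteq> 0"
    using nz[of 0] nz[of "Suc 0"] nz[of "Suc (Suc 0)"] nz[of "Suc (Suc (Suc 0))"] by simp_all
  then have "somos4_invariant \<alpha> \<beta> a b c d * (a * b * c * d) =
      a ^ 2 * d ^ 2 + \<alpha> * (b ^ 3 * d + a * c ^ 3) + \<beta> * b ^ 2 * c ^ 2"
    by (simp add: somos4_invariant_def)
  moreover have "somos4_iter \<alpha> \<beta> a b c d 0 = a" "somos4_iter \<alpha> \<beta> a b c d 1 = b"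
    "somos4_iter \<alpha> \<beta> a b c d 2 = c" "somos4_iter \<alpha> \<beta> a b c d 3 = d"
    by (simp_all add: numeral_2_eq_2 numeral_3_eq_3)
  ultimately show "somos4_invariant \<alpha> \<beta> a b c d * 1 * 1 * somos4_iter \<alpha> \<beta> a b c d 0
      * somos4_iter \<alpha> \<beta> a b c d 1 * somos4_iter \<alpha> \<beta> a b c d 2 * somos4_iter \<alpha> \<beta> a b c d 3 =
    1 * 1 * ((somos4_iter \<alpha> \<beta> a b c d 0)\<^sup>2 * (somos4_iter \<alpha> \<beta> a b c d 3)\<^sup>2
      + \<beta> * (somos4_iter \<alpha> \<beta> a b c d 1)\<^sup>2 * (somos4_iter \<alpha> \<beta> a b c d 2)\<^sup>2)
    + \<alpha> * (1\<^sup>2 * somos4_iter \<alpha> \<beta> a b c d 1 ^ 3 * somos4_iter \<alpha> \<beta> a b c d 3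
      + 1\<^sup>2 * somos4_iter \<alpha> \<beta> a b c d 0 * somos4_iter \<alpha> \<beta> a b c d 2 ^ 3)"
    by (simp add: algebra_simps)
qed (use nz in auto)

abbreviation "X\<^sub>\<alpha> \<equiv> indet_fun Alpha"
abbreviation "X\<^sub>\<beta> \<equiv> indet_fun Beta"
abbreviation "T_formal \<equiv>
  somos4_invariant X\<^sub>\<alpha> X\<^sub>\<beta> (indet_fun X1) (indet_fun X2) (indet_fun X3) (indet_fun X4)"
abbreviation "I_formal \<equiv> X\<^sub>\<alpha> ^ 2 + X\<^sub>\<beta> * T_formal"
abbreviation "somos4_generic \<equiv>
  somos4_iter X\<^sub>\<alpha> X\<^sub>\<beta> (indet_fun X1) (indet_fun X2) (indet_fun X3) (indet_fun X4)"

lemma has_value_at_T_formal: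
  assumes "a \<noteq> 0" "b \<noteq> 0" "c \<noteq> 0" "d \<noteq> 0"
  shows "has_value_at T_formal (case_indet \<alpha> \<beta> a b c d) (somos4_invariant \<alpha> \<beta> a b c d)"
proof -
  let ?x = "case_indet \<alpha> \<beta> a b c d"
  have "has_value_at T_formal ?x
    (somos4_invariant (?x Alpha) (?x Beta) (?x X1) (?x X2) (?x X3) (?x X4))"
    unfolding somos4_invariant_def
    by (intro has_value_at_intros) (use assms in simp)
  then show ?thesis by simp
qed

lemma has_value_at_I_formal:
  assumes "a \<noteq> 0" "b \<noteq> 0" "c \<noteq> 0" "d \<noteq> 0"
  shows "has_value_at I_formal (case_indet \<alpha> \<beta> a b c d) (\<alpha> ^ 2 + \<beta> * somos4_invariant \<alpha> \<beta> a b c d)"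
proof -
  let ?x = "case_indet \<alpha> \<beta> a b c d"
  have "has_value_at I_formal ?x ((?x Alpha) ^ 2 + ?x Beta * somos4_invariant \<alpha> \<beta> a b c d)"
    by (intro has_value_at_add has_value_at_mult has_value_at_power has_value_at_indet
        has_value_at_T_formal assms)
  then show ?thesis by simp
qed

text \<open>At this point \<open>f\<^sub>n = 1\<close> is a fixed point of \<open>f\<^sub>n\<^sub>+\<^sub>1 f\<^sub>n\<^sup>2 f\<^sub>n\<^sub>-\<^sub>1 = \<alpha> f\<^sub>n + \<beta>\<close> and \<open>T = 6\<close>. The parameters
\<open>\<alpha> = 4\<close> and \<open>\<beta> = -3\<close> are those for which \<open>W\<^sub>n = n\<close> is the companion sequence, because
\<open>\<alpha> = W\<^sub>2\<^sup>2\<close> and \<open>\<beta> = - W\<^sub>3\<close>; and \<open>\<alpha>\<^sup>2 + \<beta> T = -2\<close> is then \<open>- W\<^sub>4 / W\<^sub>2\<close>. Apart from \<open>W\<^sub>0\<close>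
no term of either sequence vanishes there, hence none vanishes identically.\<close>
abbreviation "degenerate_point \<equiv> case_indet 4 (- 3) 1 1 1 (1 :: complex)"

lemma indet_at_degenerate_point:
  "has_value_at X\<^sub>\<alpha> degenerate_point 4" "has_value_at X\<^sub>\<beta> degenerate_point (- 3)"
  "has_value_at (indet_fun X1) degenerate_point 1" "has_value_at (indet_fun X2) degenerate_point 1"
  "has_value_at (indet_fun X3) degenerate_point 1" "has_value_at (indet_fun X4) degenerate_point 1"
  using has_value_at_indet[of Alpha degenerate_point] has_value_at_indet[of Beta degenerate_point]
    has_value_at_indet[of X1 degenerate_point] has_value_at_indet[of X2 degenerate_point]
    has_value_at_indet[of X3 degenerate_point] has_value_at_indet[of X4 degenerate_point]
  by simp_all

lemma I_formal_at_degenerate_point: "has_value_at I_formal degenerate_point (- 2)"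
  using has_value_at_I_formal[of 1 1 1 1 4 "- 3"] by (simp add: somos4_invariant_def)

lemma X\<^sub>\<alpha>_nonzero: "X\<^sub>\<alpha> \<noteq> 0"
  using nonzero_if_has_value_at[OF indet_at_degenerate_point(1)] by simp

lemma somos4_generic_at_degenerate_point: "has_value_at (somos4_generic n) degenerate_point 1"
proof (induction n rule: less_induct)
  case (less n)
  consider "n = 0" | "n = 1" | "n = 2" | "n = 3" | k where "n = k + 4"
  proof (cases "n \<le> 3")
    case True
    then show ?thesis using that by linarith
  next
    case False
    then have "n = (n - 4) + 4" by simp
    then show ?thesis by (rule that(5))
  qed
  then show ?case
  proof cases
    case 5
    have IH: "has_value_at (somos4_generic j) degenerate_point 1" if "j < k + 4" for j
      using less.IH 5 that by simp
    have "has_value_at (somos4_generic (k + 4)) degenerate_point ((4 * 1 * 1 + (- 3) * 1 ^ 2) / 1)"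
      unfolding somos4_iter_shift
      by (intro has_value_at_intros indet_at_degenerate_point IH) auto
    then show ?thesis using 5 by simp
  qed (simp_all add: numeral_2_eq_2 numeral_3_eq_3 indet_at_degenerate_point)
qed

lemma companion_generic_at_degenerate_point:
  "has_value_at (companion_eds X\<^sub>\<alpha> X\<^sub>\<beta> I_formal n) degenerate_point
     (if even n then of_nat n / 2 else of_nat n)"
proof (induction n rule: less_induct)
  case (less n)
  consider "n = 0" | "n = 1" | "n = 2" | "n = 3" | "n = 4" | k where "n = k + 5"
  proof (cases "n \<le> 4")
    case True
    then show ?thesis using that by linarith
  next
    case False
    then have "n = (n - 5) + 5" by simp
    then show ?thesis by (rule that(6))
  qed
  then show ?case
  proof cases
    case 1
    then show ?thesis by (simp add: has_value_at_zero)
  next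
    case 4
    have "has_value_at (- X\<^sub>\<beta>) degenerate_point (- (- 3))"
      by (intro has_value_at_intros indet_at_degenerate_point)
    then show ?thesis using 4 by (simp add: numeral_3_eq_3)
  next
    case 5
    have "has_value_at (- I_formal) degenerate_point (- (- 2))"
      by (rule has_value_at_uminus[OF I_formal_at_degenerate_point])
    then show ?thesis unfolding 5 companion_eds_4 by simp
  next
    case 6
    let ?u = "\<lambda>n :: nat. if even n then of_nat n / 2 else of_nat n :: complex"
    have IH: "has_value_at (companion_eds X\<^sub>\<alpha> X\<^sub>\<beta> I_formal j) degenerate_point (?u j)" if "j < k + 5" for j
      using less.IH 6 that by simp
    have weight: "has_value_at (parity_weight X\<^sub>\<alpha> k) degenerate_point (if even k then 4 else 1)"
      using indet_at_degenerate_point(1) has_value_at_one by (simp add: parity_weight_def)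
    have nz: "?u (k + 1) \<noteq> 0"
      using of_nat_neq_0[of k, where 'a = complex] by (simp del: of_nat_Suc)
    have "has_value_at (companion_eds X\<^sub>\<alpha> X\<^sub>\<beta> I_formal (k + 5)) degenerate_point
      (((if even k then 4 else 1) ^ 2 * ?u (k + 4) * ?u (k + 2) + (- 3) * ?u (k + 3) ^ 2) / ?u (k + 1))"
      unfolding companion_shift
      by (intro has_value_at_add has_value_at_mult has_value_at_divide has_value_at_power
        indet_at_degenerate_point IH weight nz) auto
    also have "((if even k then 4 else 1) ^ 2 * ?u (k + 4) * ?u (k + 2) + (- 3) * ?u (k + 3) ^ 2) / ?u (k + 1)
       = ?u (k + 5)"
    proof -
      have "(if even k then 4 else 1) ^ 2 * ?u (k + 4) * ?u (k + 2) + (- 3) * ?u (k + 3) ^ 2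
        = ?u (k + 5) * ?u (k + 1)"
        by (cases "even k") (simp_all add: field_simps power2_eq_square)
      then show ?thesis using nonzero_divide_eq_eq[OF nz] by blast
    qed
    finally show ?thesis unfolding 6 .
  qed (simp_all add: has_value_at_one numeral_2_eq_2)
qed

lemma somos4_generic_nonzero: "somos4_generic n \<noteq> 0"
  using nonzero_if_has_value_at[OF somos4_generic_at_degenerate_point] by simp

lemma somos4_companion_generic: "somos4_companion X\<^sub>\<alpha> X\<^sub>\<beta> T_formal"
proof
  show "companion_eds X\<^sub>\<alpha> X\<^sub>\<beta> I_formal n \<noteq> 0" if "n > 0" for n
    using nonzero_if_has_value_at[OF companion_generic_at_degenerate_point[of n]] that by simp
qed (rule X\<^sub>\<alpha>_nonzero)

section \<open>The ring generated by the data\<close>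

lemma generate_ring_closed_set:
  "ring_closed_set (generate_ring (ring_of_type_algebra :: complex ring) H)" (is "ring_closed_set ?R")
proof
  show "1 \<in> ?R" using generate_ring.one[of "ring_of_type_algebra :: complex ring" H]
    by (simp add: ring_of_type_algebra_def)
  fix x y assume x: "x \<in> ?R"
  have "a_inv (ring_of_type_algebra :: complex ring) x = - x"
  proof -
    interpret R: cring "ring_of_type_algebra :: complex ring" by (rule cring_from_type_algebra)
    show ?thesis by (rule R.minus_equality) (simp_all add: ring_of_type_algebra_def)
  qed
  then show "- x \<in> ?R" using generate_ring.a_inv[OF x] by simp
  assume y: "y \<in> ?R"
  show "x + y \<in> ?R" "x * y \<in> ?R"
    using generate_ring.eng_add[OF x y] generate_ring.eng_mult[OF x y]
    by (simp_all add: ring_of_type_algebra_def)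
qed

text \<open>This ring turns a statement about rational functions into one about their values: if a rational
function belongs to it, then it has a value at \<open>x\<close>, and the value lies in \<open>R\<close>.\<close>
lemma ring_closed_set_values_in:
  assumes "ring_closed_set R"
  shows "ring_closed_set {r. \<exists>v\<in>R. has_value_at r x v}"
proof -
  interpret ring_closed_set R by fact
  show ?thesis
  proof
    show "1 \<in> {r. \<exists>v\<in>R. has_value_at r x v}"
      using one has_value_at_one by auto
  qed (auto intro: add uminus mult has_value_at_add has_value_at_uminus has_value_at_mult)
qed

theorem theorem3p1:
  fixes \<alpha> \<beta> A\<^sub>1 A\<^sub>2 A\<^sub>3 A\<^sub>4 T I :: complex
  assumes "A\<^sub>1 \<noteq> 0" and "A\<^sub>2 \<noteq> 0" and "A\<^sub>3 \<noteq> 0" and "A\<^sub>4 \<noteq> 0"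
    and "T = (A\<^sub>1\<^sup>2 * A\<^sub>4\<^sup>2 + \<alpha> * (A\<^sub>2 ^ 3 * A\<^sub>4 + A\<^sub>1 * A\<^sub>3 ^ 3) + \<beta> * A\<^sub>2\<^sup>2 * A\<^sub>3\<^sup>2)
             / (A\<^sub>1 * A\<^sub>2 * A\<^sub>3 * A\<^sub>4)"
    and "I = \<alpha>\<^sup>2 + \<beta> * T"
  shows "\<forall>n::int. n \<ge> 1 \<longrightarrow>
           somos4 \<alpha> \<beta> A\<^sub>1 A\<^sub>2 A\<^sub>3 A\<^sub>4 n
             \<in> generate_ring (ring_of_type_algebra :: complex ring)
                  {\<alpha>, \<beta>, I, A\<^sub>1, inverse A\<^sub>1, A\<^sub>2, A\<^sub>3, A\<^sub>4}"
proof (intro allI impI)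
  fix n :: int
  assume "n \<ge> 1"
  let ?x = "case_indet \<alpha> \<beta> A\<^sub>1 A\<^sub>2 A\<^sub>3 A\<^sub>4"
  let ?R = "generate_ring (ring_of_type_algebra :: complex ring)
                  {\<alpha>, \<beta>, I, A\<^sub>1, inverse A\<^sub>1, A\<^sub>2, A\<^sub>3, A\<^sub>4}"
  \<comment> \<open>The generic sequence is shown to lie in the ring of rational functions with value in \<open>?R\<close>.\<close>
  let ?S = "{r. \<exists>v\<in>?R. has_value_at r ?x v}"
  have indet: "indet_fun i \<in> ?S" for i
    using has_value_at_indet[of i ?x] by (cases i) (auto intro: generate_ring.incl)
  have "has_value_at I_formal ?x I"
    using has_value_at_I_formal[of A\<^sub>1 A\<^sub>2 A\<^sub>3 A\<^sub>4 \<alpha> \<beta>] assms by (simp add: somos4_invariant_def)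
  then have I: "I_formal \<in> ?S" by (auto intro: generate_ring.incl)
  have "has_value_at (1 / indet_fun X1) ?x (1 / A\<^sub>1)"
    using assms(1) has_value_at_indet[of X1 ?x] by (intro has_value_at_intros) auto
  then have inverse: "inverse (indet_fun X1) \<in> ?S"
    by (auto simp: inverse_eq_divide intro: generate_ring.incl)
  have "somos4_generic k \<in> ?S" for k
  proof (rule somos4_companion.somos4_in_subring[OF somos4_companion_generic])
    show "twisted_somos4 X\<^sub>\<alpha> X\<^sub>\<beta> T_formal (\<lambda>_. 1) somos4_generic"
      by (rule twisted_somos4_iter[OF somos4_generic_nonzero])
    show "ring_closed_set ?S"
      by (rule ring_closed_set_values_in[OF generate_ring_closed_set])
  qed (use indet I inverse in \<open>simp_all add: numeral_2_eq_2 numeral_3_eq_3\<close>)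
  from this[of "nat (n - 1)"] obtain v where "v \<in> ?R" "has_value_at (somos4_formal n) ?x v"
    using \<open>n \<ge> 1\<close> by (auto simp: somos4_formal_def)
  then show "somos4 \<alpha> \<beta> A\<^sub>1 A\<^sub>2 A\<^sub>3 A\<^sub>4 n \<in> ?R"
    by (simp add: somos4_def ratfun_value_eqI)
qed

end
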